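(* For any $\epsilon > 0$ the following holds for all sufficiently large integers $r$: there is an online randomized algorithm that $r$-colors the edges arriving in $(1-\epsilon)rn$ rounds of the online random edge process on $n$ vertices such that, with high probability, every connected component of every color class has order $o(n)$.
   Context: Online random edge process: there are $n$ vertices and a sequence of rounds; in each round one edge arrives, chosen uniformly at random among all pairs of distinct vertices, independently of previous rounds (repetitions are possible and need not be recolored). The algorithm must assign a color to each edge upon its arrival, using only the history of the process so far (and, if randomized, its own independent random bits). "With high probability" means with probability tending to $1$ as $n\to\infty$. *)

theory Defs
  imports "HOL-Probability.Probability" "HOL-Library.Landau_Symbols"
begin

(* An edge {u, v} with u < v is represented by the pair (u, v). The edge type is thus countable,
   so that the events below are measurable in the product with the uncountable space of bits. *)
type_synonym edge = "nat \<times> nat"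

definition edges :: "nat \<Rightarrow> edge set" where
  "edges n = {(u, v). u < v \<and> v < n}"

(* The edges arriving in T rounds, in order of arrival. For n < 2 there are no edges and
   pmf_of_set is unspecified; only the limit in n is ever used. *)
definition edge_process :: "nat \<Rightarrow> nat \<Rightarrow> edge list pmf" where
  "edge_process n T = replicate_pmf T (pmf_of_set (edges n))"

definition random_bits :: "(nat \<Rightarrow> bool) measure" where
  "random_bits = (\<Pi>\<^sub>M i\<in>UNIV. measure_pmf (bernoulli_pmf (1/2)))"

(* alg \<omega> past e is the color given to the arriving edge e, where past lists the edges of the
   previous rounds and \<omega> is the sequence of random bits. The earlier colors are functions of
   past and \<omega>, hence need not be passed as arguments. *)
type_synonym online_alg = "(nat \<Rightarrow> bool) \<Rightarrow> edge list \<Rightarrow> edge \<Rightarrow> nat"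

definition randomized_online_algorithm :: "nat \<Rightarrow> online_alg \<Rightarrow> bool" where
  "randomized_online_algorithm r alg \<longleftrightarrow>
     (\<forall>past e. (\<lambda>\<omega>. alg \<omega> past e) \<in> measurable random_bits (count_space UNIV)) \<and>
     (\<forall>\<omega> past e. alg \<omega> past e \<in> {..<r})"

(* An edge keeps the color received at its first arrival; repeated arrivals are ignored. *)
definition color_class :: "online_alg \<Rightarrow> (nat \<Rightarrow> bool) \<Rightarrow> edge list \<Rightarrow> nat \<Rightarrow> edge set" where
  "color_class alg \<omega> es c =
     {es ! i | i. i < length es \<and> es ! i \<notin> set (take i es) \<and> alg \<omega> (take i es) (es ! i) = c}"

definition connected_in :: "nat \<Rightarrow> edge set \<Rightarrow> (nat \<times> nat) set" where
  "connected_in n F = {(u, v). u < n \<and> v < n \<and> (u, v) \<in> (F \<union> F\<inverse>)\<^sup>*}"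

(* Vertex sets of the connected components of the graph with vertices 0, ..., n - 1 and
   edge set F; isolated vertices count as components. *)
definition components_of_graph :: "nat \<Rightarrow> edge set \<Rightarrow> nat set set" where
  "components_of_graph n F = {..<n} // connected_in n F"

end

(* Let r = R + 1. Every arriving edge is oriented at random, and the j-th edge leaving a vertex v,
   counted from j = 0, gets color (J v + j) mod R if j < R, with J v a uniformly random shift; the
   remaining edges overflow into color R. In a color below R no vertex has two outgoing arcs, so
   every simple path consists of a forward and a backward part and its k arcs have distinct sources.
   Whatever the index j, the random shift gives the arc that color with probability 1/R, so a
   union bound over the rounds shows that a fixed path is present with probability at most (\<rho>/n)^k,
   where \<rho> < 1; the expected number of connected pairs of vertices is thus O(n). A vertex sends
   more than R edges with probability exponentially small in R, which for large R makes the overflow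
   color subcritical as well. By Markov's inequality no component exceeds n^(3/4) in size with high
   probability. Averaging over orientations and shifts then fixes one choice of them for each n, so the
   algorithm is even deterministic. *)
theory Submission
  imports Defs "HOL-Real_Asymp.Real_Asymp"
begin

section \<open>Product distributions: conditioning, independence and first moments\<close>

section \<open>Independent choices and the oriented edge process\<close>

text \<open>Tonelli. With the rounds as first coordinate and the shifts as second, it suffices to
  bound the shifts for fixed arrivals.\<close>

lemma prob_pair_pmf_le:
  assumes "\<And>x. P x \<Longrightarrow> measure_pmf.prob B {y. Q x y} \<le> c" "0 \<le> c"
  shows "measure_pmf.prob (pair_pmf A B) {(x, y). P x \<and> Q x y} \<le> measure_pmf.prob A {x. P x} * c"
proof -
  have "emeasure (pair_pmf A B) {(x, y). P x \<and> Q x y}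
      = (\<integral>\<^sup>+z. indicator {(x, y). P x \<and> Q x y} z \<partial>pair_pmf A B)"
    by simp
  also have "\<dots> = (\<integral>\<^sup>+x. \<integral>\<^sup>+y. indicator {x. P x} x * indicator {y. Q x y} y \<partial>B \<partial>A)"
    unfolding nn_integral_pair_pmf'
    by (intro nn_integral_cong) (auto simp: indicator_def)
  also have "\<dots> = (\<integral>\<^sup>+x. indicator {x. P x} x * emeasure B {y. Q x y} \<partial>A)"
    by (intro nn_integral_cong) (simp add: nn_integral_cmult)
  also have "\<dots> \<le> (\<integral>\<^sup>+x. indicator {x. P x} x * ennreal c \<partial>A)"
    using assms
    by (intro nn_integral_mono) (auto simp: indicator_def measure_pmf.emeasure_eq_measure ennreal_leI)
  also have "\<dots> = emeasure A {x. P x} * ennreal c"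
    by (simp add: nn_integral_multc)
  finally show ?thesis
    using assms(2) by (simp add: measure_pmf.emeasure_eq_measure ennreal_mult[symmetric])
qed

text \<open>The averaging argument that fixes the seeds in the end: if every section had probability
  at least \<open>c\<close>, so would the whole event.\<close>

lemma exists_prob_section_less:
  assumes "measure_pmf.prob (pair_pmf A B) {(x, y). Q x y} < c"
  shows "\<exists>x. measure_pmf.prob B {y. Q x y} < c"
proof (rule ccontr)
  assume "\<not> ?thesis"
  then have c: "ennreal c \<le> emeasure B {y. Q x y}" for x
    by (simp add: measure_pmf.emeasure_eq_measure not_less ennreal_leI)
  have "emeasure (pair_pmf A B) {(x, y). Q x y}
      = (\<integral>\<^sup>+z. indicator {(x, y). Q x y} z \<partial>pair_pmf A B)"
    by simp
  also have "\<dots> = (\<integral>\<^sup>+x. \<integral>\<^sup>+y. indicator {y. Q x y} y \<partial>B \<partial>A)"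
    unfolding nn_integral_pair_pmf'
    by (intro nn_integral_cong) (auto simp: indicator_def)
  also have "\<dots> = (\<integral>\<^sup>+x. emeasure B {y. Q x y} \<partial>A)"
    by simp
  also have "\<dots> \<ge> (\<integral>\<^sup>+x. ennreal c \<partial>A)"
    by (intro nn_integral_mono c)
  finally have "ennreal c \<le> emeasure (pair_pmf A B) {(x, y). Q x y}"
    by simp
  then show False
    using assms by (simp add: measure_pmf.emeasure_eq_measure)
qed

lemma prob_Pi_pmf_injective:
  assumes "finite A" "inj_on \<sigma> {..<k::nat}" "\<sigma> ` {..<k} \<subseteq> A"
  shows "measure_pmf.prob (Pi_pmf A d p) {f. \<forall>i<k. f (\<sigma> i) \<in> B i}
       = (\<Prod>i<k. measure_pmf.prob (p (\<sigma> i)) (B i))"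
proof -
  \<comment> \<open>\<open>B' t\<close> is \<open>B i\<close> for the unique \<open>i\<close> with
    \<open>\<sigma> i = t\<close> and \<open>UNIV\<close> off the image of \<sigma>, which turns the
    event into a product set over \<open>A\<close>.\<close>
  define B' where "B' t = {y. \<forall>i<k. \<sigma> i = t \<longrightarrow> y \<in> B i}" for t
  have B': "B' (\<sigma> i) = B i" if "i < k" for i
    using that assms(2) by (auto simp: B'_def inj_on_def)
  have "{f. \<forall>i<k. f (\<sigma> i) \<in> B i} = Pi A B'"
    using assms(3) by (fastforce simp: B'_def)
  then have "measure_pmf.prob (Pi_pmf A d p) {f. \<forall>i<k. f (\<sigma> i) \<in> B i}
      = (\<Prod>t\<in>A. measure_pmf.prob (p t) (B' t))"
    using assms(1) by (simp add: measure_Pi_pmf_Pi)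
  also have "\<dots> = (\<Prod>t\<in>\<sigma> ` {..<k}. measure_pmf.prob (p t) (B' t))"
  proof (intro prod.mono_neutral_right ballI)
    fix t assume "t \<in> A - \<sigma> ` {..<k}"
    then have "B' t = UNIV"
      by (auto simp: B'_def)
    then show "measure_pmf.prob (p t) (B' t) = 1"
      by simp
  qed (use assms in auto)
  also have "\<dots> = (\<Prod>i<k. measure_pmf.prob (p (\<sigma> i)) (B' (\<sigma> i)))"
    using assms(2) by (simp add: prod.reindex)
  also have "\<dots> = (\<Prod>i<k. measure_pmf.prob (p (\<sigma> i)) (B i))"
    by (intro prod.cong) (simp_all add: B')
  finally show ?thesis .
qed

text \<open>Markov's inequality for the number of events that occur; the sum on the right is the
  expectation of that number.\<close>

lemma markov_count:
  assumes "finite C"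
  shows "m * measure_pmf.prob M {w. m \<le> real (card {c \<in> C. Q c w})}
       \<le> (\<Sum>c\<in>C. measure_pmf.prob M {w. Q c w})"
proof -
  let ?X = "\<lambda>w. \<Sum>c\<in>C. indicator {w. Q c w} w :: real"
  have card: "real (card {c \<in> C. Q c w}) = ?X w" for w
    using assms by (simp add: indicator_def sum.If_cases Int_def)
  have int: "integrable (measure_pmf M) ?X"
    by (intro Bochner_Integration.integrable_sum measure_pmf.integrable_const_bound[where B = 1]) auto
  have "measure_pmf.expectation M (\<lambda>w. m * indicator {w. m \<le> ?X w} w) \<le> measure_pmf.expectation M ?X"
  proof (rule integral_mono[OF _ int])
    show "integrable (measure_pmf M) (\<lambda>w. m * indicator {w. m \<le> ?X w} w)"
      by (intro integrable_mult_right measure_pmf.integrable_const_bound[where B = 1]) auto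
    show "m * indicator {w. m \<le> ?X w} w \<le> ?X w" for w
      using sum_nonneg[of C "\<lambda>c. indicator {w. Q c w} w :: real"] by (auto simp: indicator_def)
  qed
  also have "\<dots> = (\<Sum>c\<in>C. measure_pmf.prob M {w. Q c w})"
    by (subst Bochner_Integration.integral_sum) (simp_all add: measure_pmf.integrable_const_bound[where B = 1])
  finally show ?thesis
    by (simp add: card)
qed

text \<open>Used to separate the arriving edges from their orientations.\<close>

lemma Pi_pmf_pair:
  assumes "finite A"
  shows "map_pmf (\<lambda>(f, g) x. (f x, g x)) (pair_pmf (Pi_pmf A d1 p) (Pi_pmf A d2 q))
       = Pi_pmf A (d1, d2) (\<lambda>x. pair_pmf (p x) (q x))"
proof (rule pmf_eqI)
  fix h :: "'a \<Rightarrow> 'b \<times> 'c"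
  let ?F = "\<lambda>(f, g) x. (f x, g x)" and ?hh = "(\<lambda>x. fst (h x), \<lambda>x. snd (h x))"
  have inj: "inj ?F"
    by (auto simp: inj_def fun_eq_iff)
  have h: "h = ?F ?hh"
    by simp
  have "pmf (map_pmf ?F (pair_pmf (Pi_pmf A d1 p) (Pi_pmf A d2 q))) (?F ?hh)
      = pmf (pair_pmf (Pi_pmf A d1 p) (Pi_pmf A d2 q)) ?hh"
    by (rule pmf_map_inj'[OF inj])
  also have "\<dots> = pmf (Pi_pmf A (d1, d2) (\<lambda>x. pair_pmf (p x) (q x))) h"
  proof -
    have eq: "pmf (pair_pmf (p x) (q x)) (h x) = pmf (p x) (fst (h x)) * pmf (q x) (snd (h x))" for x
      using pmf_pair[of "p x" "q x" "fst (h x)" "snd (h x)"] by simp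
    have outside: "(\<forall>x. x \<notin> A \<longrightarrow> h x = (d1, d2))
        \<longleftrightarrow> (\<forall>x. x \<notin> A \<longrightarrow> fst (h x) = d1) \<and> (\<forall>x. x \<notin> A \<longrightarrow> snd (h x) = d2)"
      by (metis prod.collapse fst_conv snd_conv)
    show ?thesis
      unfolding pmf_pair pmf_Pi[OF assms] eq outside prod.distrib by auto
  qed
  finally show "pmf (map_pmf ?F (pair_pmf (Pi_pmf A d1 p) (Pi_pmf A d2 q))) h
      = pmf (Pi_pmf A (d1, d2) (\<lambda>x. pair_pmf (p x) (q x))) h"
    using h by simp
qed

text \<open>Rounds become coordinates of a function, so that the independence results for
  \<open>Pi_pmf\<close> apply.\<close>

lemma replicate_pmf_eq_Pi_pmf:
  "replicate_pmf T p = map_pmf (\<lambda>f. map f [0..<T]) (Pi_pmf {..<T} d (\<lambda>_. p))"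
proof (induction T)
  case (Suc T)
  have "replicate_pmf (Suc T) p = replicate_pmf (T + 1) p"
    by simp
  also have "\<dots> = do {xs \<leftarrow> replicate_pmf T p; y \<leftarrow> p; return_pmf (xs @ [y])}"
    by (subst replicate_pmf_distrib) (simp add: bind_assoc_pmf bind_return_pmf)
  also have "\<dots> = do {f \<leftarrow> Pi_pmf {..<T} d (\<lambda>_. p); y \<leftarrow> p; return_pmf (map f [0..<T] @ [y])}"
    by (simp add: Suc.IH map_pmf_def bind_assoc_pmf bind_return_pmf)
  also have "\<dots> = do {y \<leftarrow> p; f \<leftarrow> Pi_pmf {..<T} d (\<lambda>_. p); return_pmf (map (f(T := y)) [0..<Suc T])}"
    by (subst bind_commute_pmf) simp
  also have "\<dots> = map_pmf (\<lambda>f. map f [0..<Suc T]) (Pi_pmf {..<Suc T} d (\<lambda>_. p))"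
    unfolding lessThan_Suc
    by (subst Pi_pmf_insert') (simp_all add: map_pmf_def bind_assoc_pmf bind_return_pmf)
  finally show ?case .
qed simp

section \<open>Uniform random edges with random orientation\<close>

lemma card_edges: "2 * card (edges n) = n * (n - 1)"
proof (induction n)
  case (Suc n)
  have "edges (Suc n) = edges n \<union> {..<n} \<times> {n}"
    by (auto simp: edges_def)
  moreover have "edges n \<subseteq> {..<n} \<times> {..<n}"
    by (auto simp: edges_def)
  then have "finite (edges n)" "edges n \<inter> {..<n} \<times> {n} = {}"
    by (auto intro: finite_subset)
  ultimately have "card (edges (Suc n)) = card (edges n) + n"
    by (simp add: card_Un_disjoint)
  with Suc show ?case
    by (cases n) simp_all
qed (simp add: edges_def)

lemma finite_edges: "finite (edges n)"
  by (rule finite_subset[of _ "{..<n} \<times> {..<n}"]) (auto simp: edges_def)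

text \<open>For \<open>n \<ge> 2\<close> this is the uniform distribution on ordered pairs of
  distinct vertices. Writing it as an image of an edge and a coin prepares the coupling with the
  edge process.\<close>

definition directed_edge_pmf :: "nat \<Rightarrow> edge pmf" where
  "directed_edge_pmf n = map_pmf (\<lambda>(e, b). if b then e else prod.swap e)
     (pair_pmf (pmf_of_set (edges n)) (bernoulli_pmf (1/2)))"

context
  fixes n :: nat
  assumes n: "2 \<le> n"
begin

lemma edges_nonempty: "edges n \<noteq> {}"
proof -
  have "(0, 1) \<in> edges n"
    using n by (simp add: edges_def)
  then show ?thesis
    by auto
qed

lemma set_directed_edge_pmf:
  "set_pmf (directed_edge_pmf n) \<subseteq> {(u, v). u < n \<and> v < n \<and> u \<noteq> v}"
  unfolding directed_edge_pmf_def set_map_pmf set_pair_pmf set_pmf_of_set[OF edges_nonempty finite_edges]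
  by (auto simp: edges_def split: if_splits)

lemma pmf_directed_edge_pmf_le: "pmf (directed_edge_pmf n) e \<le> 1 / (real n * (real n - 1))"
proof (cases e)
  case (Pair u v)
  define a where "a = (min u v, max u v)"
  have card: "2 * real (card (edges n)) = real n * (real n - 1)"
    using arg_cong[OF card_edges[of n], of real] n by (simp add: of_nat_diff)
  have pos: "real n * (real n - 1) > 0"
    using n by simp
  have "pmf (directed_edge_pmf n) e
      = measure_pmf.prob (pair_pmf (pmf_of_set (edges n)) (bernoulli_pmf (1/2)))
          ((\<lambda>(e, b). if b then e else prod.swap e) -` {e})"
    by (simp add: directed_edge_pmf_def pmf_map)
  \<comment> \<open>The preimage of \<open>(u, v)\<close> has two elements, but at most one with
    increasing endpoints; hence the inclusion holds almost surely.\<close>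
  also have "\<dots> \<le> measure_pmf.prob (pair_pmf (pmf_of_set (edges n)) (bernoulli_pmf (1/2))) {(a, u < v)}"
    by (intro measure_pmf.finite_measure_mono_AE, unfold AE_measure_pmf_iff set_pair_pmf
          set_pmf_of_set[OF edges_nonempty finite_edges])
       (auto simp: a_def Pair edges_def split: if_splits)
  also have "\<dots> = pmf (pmf_of_set (edges n)) a * (1/2)"
    by (simp add: measure_pmf_single pmf_pair)
  also have "\<dots> \<le> 1 / card (edges n) * (1/2)"
    by (simp add: pmf_of_set[OF edges_nonempty finite_edges] indicator_def)
  also have "\<dots> = 1 / (real n * (real n - 1))"
    using card pos by (simp add: field_simps)
  finally show ?thesis .
qed

text \<open>Each source has \<open>n - 1\<close> possible targets, of mass at most
  \<open>1 / (n (n - 1))\<close> each.\<close>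

lemma prob_directed_edge_source_le:
  assumes "finite S"
  shows "measure_pmf.prob (directed_edge_pmf n) {e. fst e \<in> S} \<le> real (card S) / real n"
proof -
  define E where "E = (SIGMA s:S. {..<n} - {s}) \<inter> {..<n} \<times> UNIV"
  have fin: "finite E"
    using assms by (auto simp: E_def)
  have "E \<subseteq> (SIGMA s:S \<inter> {..<n}. {..<n} - {s})"
    by (auto simp: E_def)
  then have "card E \<le> card (SIGMA s:S \<inter> {..<n}. {..<n} - {s})"
    using assms by (intro card_mono) auto
  also have "\<dots> = card (S \<inter> {..<n}) * (n - 1)"
    using assms by (subst card_SigmaI) auto
  also have "\<dots> \<le> card S * (n - 1)"
    using assms by (intro mult_right_mono card_mono) auto
  finally have "real (card E) \<le> real (card S * (n - 1))"
    by (rule of_nat_mono)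
  then have card: "real (card E) \<le> real (card S) * (real n - 1)"
    using n by (simp add: of_nat_diff)
  have "measure_pmf.prob (directed_edge_pmf n) {e. fst e \<in> S} \<le> measure_pmf.prob (directed_edge_pmf n) E"
    using set_directed_edge_pmf
    by (intro measure_pmf.finite_measure_mono_AE) (auto simp: AE_measure_pmf_iff E_def)
  also have "\<dots> = (\<Sum>e\<in>E. pmf (directed_edge_pmf n) e)"
    by (rule measure_measure_pmf_finite[OF fin])
  also have "\<dots> \<le> (\<Sum>e\<in>E. 1 / (real n * (real n - 1)))"
    by (intro sum_mono pmf_directed_edge_pmf_le)
  also have "\<dots> = real (card E) / (real n * (real n - 1))"
    by simp
  also have "\<dots> \<le> real (card S) * (real n - 1) / (real n * (real n - 1))"
    using n card by (intro divide_right_mono) auto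
  also have "\<dots> = real (card S) / real n"
    using n by simp
  finally show ?thesis .
qed

end

section \<open>The coloring rule; main colors have out-degree at most one\<close>

section \<open>Simple paths in a color class\<close>

definition prior :: "(nat \<Rightarrow> edge) \<Rightarrow> nat \<Rightarrow> nat" where
  "prior x t = card {i. i < t \<and> fst (x i) = fst (x t)}"

text \<open>Up to the final theorem, \<open>r\<close> is the number of main colors (the
  \<open>R\<close> of the opening comment) and color \<open>r\<close> is the overflow color.
  \<open>prior x t\<close> is the index \<open>j\<close> there.\<close>

definition round_color :: "nat \<Rightarrow> (nat \<Rightarrow> nat) \<Rightarrow> (nat \<Rightarrow> edge) \<Rightarrow> nat \<Rightarrow> nat" where
  "round_color r J x t = (if prior x t < r then (J (fst (x t)) + prior x t) mod r else r)"

text \<open>Repeated arrivals contribute arcs as well, so this only bounds a color class from above,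
  up to direction.\<close>

definition arcs :: "nat \<Rightarrow> nat \<Rightarrow> (nat \<Rightarrow> nat) \<Rightarrow> (nat \<Rightarrow> edge) \<Rightarrow> nat \<Rightarrow> edge set" where
  "arcs T r J x c = {x t | t. t < T \<and> round_color r J x t = c}"

lemma prior_less:
  assumes "s < t" "fst (x s) = fst (x t)"
  shows "prior x s < prior x t"
  unfolding prior_def using assms by (intro psubset_card_mono) auto

lemma inj_on_add_mod: "inj_on (\<lambda>a. (m + a) mod r) {..<r :: nat}"
proof (rule linorder_inj_onI)
  fix a b assume ab: "a < b" "a \<in> {..<r}" "b \<in> {..<r}"
  show "(m + a) mod r \<noteq> (m + b) mod r"
  proof
    assume "(m + a) mod r = (m + b) mod r"
    then have "r dvd (m + b) - (m + a)"
      using ab by (metis add_le_cancel_left less_imp_le mod_eq_dvd_iff_nat)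
    with ab show False
      by (auto dest: dvd_imp_le)
  qed
qed auto

text \<open>Arcs with a common source share the shift, so equal colors force equal indices below
  \<open>r\<close>. Indices increase strictly along the rounds with that source, hence the two
  rounds coincide.\<close>

lemma single_valued_arcs:
  assumes "c < r"
  shows "single_valued (arcs T r J x c)"
proof (rule single_valuedI)
  fix u v w assume "(u, v) \<in> arcs T r J x c" "(u, w) \<in> arcs T r J x c"
  then obtain s t where s: "x s = (u, v)" "round_color r J x s = c"
    and t: "x t = (u, w)" "round_color r J x t = c"
    by (auto simp: arcs_def)
  have color: "prior x i < r \<and> (J u + prior x i) mod r = c"
    if "fst (x i) = u" "round_color r J x i = c" for i
    using that assms unfolding round_color_def by (metis less_irrefl)
  have fst: "fst (x s) = u" "fst (x t) = u"
    using s(1) t(1) by simp_all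
  have "prior x s = prior x t"
    using inj_onD[OF inj_on_add_mod, of "J u" "prior x s" r "prior x t"]
      color[OF fst(1) s(2)] color[OF fst(2) t(2)] by (metis lessThan_iff)
  then have "s = t"
    using prior_less[of s t x] prior_less[of t s x] fst by (cases s t rule: linorder_cases) auto
  with s(1) t(1) show "v = w"
    by simp
qed

section \<open>Connected pairs, simple paths and their orientations\<close>

lemma rtrancl_imp_simple_path:
  assumes "(u, v) \<in> R\<^sup>*"
  obtains k and p :: "nat \<Rightarrow> 'a"
  where "p 0 = u" "p k = v" "inj_on p {..k}" "\<And>i. i < k \<Longrightarrow> (p i, p (Suc i)) \<in> R"
proof -
  define k where "k = (LEAST k. (u, v) \<in> R ^^ k)"
  have "(u, v) \<in> R ^^ k"
    using assms unfolding k_def rtrancl_power by (rule LeastI_ex)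
  then obtain p where p: "p 0 = u" "p k = v" "\<And>i. i < k \<Longrightarrow> (p i, p (Suc i)) \<in> R"
    by (auto simp: relpow_fun_conv)
  have "p i \<noteq> p j" if "i < j" "j \<le> k" for i j
  proof
    assume eq: "p i = p j"
    have "(u, p i) \<in> R ^^ i"
      using p that by (auto simp: relpow_fun_conv intro!: exI[of _ p])
    moreover have "(p j, v) \<in> R ^^ (k - j)"
      using p that by (auto simp: relpow_fun_conv intro!: exI[of _ "\<lambda>i. p (i + j)"])
    \<comment> \<open>Cutting out the loop between the equal vertices gives a walk shorter than the
      minimal length \<open>k\<close>.\<close>
    ultimately have "(u, v) \<in> R ^^ (i + (k - j))"
      unfolding relpow_add eq by (rule relcompI)
    then have "k \<le> i + (k - j)"
      unfolding k_def by (rule Least_le)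
    with that show False
      by simp
  qed
  then have "inj_on p {..k}"
    by (intro linorder_inj_onI) auto
  with p that show ?thesis
    by blast
qed

definition path_arc :: "(nat \<Rightarrow> nat) \<Rightarrow> (nat \<Rightarrow> bool) \<Rightarrow> nat \<Rightarrow> edge" where
  "path_arc p b i = (if b i then (p i, p (Suc i)) else (p (Suc i), p i))"

definition simple_paths :: "nat \<Rightarrow> nat \<Rightarrow> (nat \<Rightarrow> nat) set" where
  "simple_paths n k = {p \<in> {..k} \<rightarrow>\<^sub>E {..<n}. inj_on p {..k}}"

lemma finite_simple_paths [simp]: "finite (simple_paths n k)"
  unfolding simple_paths_def
  by (rule finite_subset[of _ "{..k} \<rightarrow>\<^sub>E {..<n}"]) (auto intro!: finite_PiE)

lemma card_simple_paths_le: "card (simple_paths n k) \<le> n ^ Suc k"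
proof -
  have "card (simple_paths n k) \<le> card ({..k} \<rightarrow>\<^sub>E {..<n})"
    unfolding simple_paths_def by (intro card_mono) (auto intro!: finite_PiE)
  also have "\<dots> = n ^ Suc k"
    by (simp add: card_PiE)
  finally show ?thesis .
qed

lemma connected_imp_oriented_path:
  assumes "(u, v) \<in> (F \<union> F\<inverse>)\<^sup>*" "F \<subseteq> {..<n} \<times> {..<n}" "u < n"
  obtains k p b where "k < n" "p \<in> simple_paths n k" "p 0 = u" "p k = v"
    "\<And>i. i < k \<Longrightarrow> path_arc p b i \<in> F"
proof -
  obtain k p where p: "p 0 = u" "p k = v" "inj_on p {..k}"
    and step: "\<And>i. i < k \<Longrightarrow> (p i, p (Suc i)) \<in> F \<union> F\<inverse>"
    using rtrancl_imp_simple_path[OF assms(1)] by metis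
  have less: "p i < n" if "i \<le> k" for i
    using step[of "i - 1"] assms(2,3) p(1) that by (cases i) auto
  \<comment> \<open>Pigeonhole: the \<open>k + 1\<close> vertices of the path are distinct.\<close>
  have "card {..k} \<le> card {..<n}"
    using p(3) less by (intro card_inj_on_le[of p]) auto
  then have "k < n"
    by simp
  moreover have "restrict p {..k} \<in> simple_paths n k"
    using p less by (auto simp: simple_paths_def inj_on_def)
  moreover have "path_arc (restrict p {..k}) (\<lambda>i. (p i, p (Suc i)) \<in> F) i \<in> F" if "i < k" for i
    using step[OF that] that by (auto simp: path_arc_def)
  ultimately show ?thesis
    using p(1,2) by (intro that[of k "restrict p {..k}"]) auto
qed

text \<open>An arc traversed backwards cannot be followed by one traversed forwards, since both would leave
  the same vertex.\<close>

lemma single_valued_path_orientation: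
  assumes F: "single_valued F" and p: "inj_on p {..k}"
    and arc: "\<And>i. i < k \<Longrightarrow> path_arc p b i \<in> F"
  shows "\<exists>a\<le>k. \<forall>i<k. b i \<longleftrightarrow> i < a"
proof -
  \<comment> \<open>\<open>a\<close> is the first backward step, or \<open>k\<close> if there is
    none; the alternative \<open>k \<le> i\<close> ensures that the minimum exists.\<close>
  define a where "a = (LEAST i. k \<le> i \<or> \<not> b i)"
  have a: "k \<le> a \<or> \<not> b a"
    unfolding a_def by (rule LeastI[of _ k]) simp
  have "a \<le> k"
    unfolding a_def by (rule Least_le) simp
  moreover have "b i" if "i < a" for i
    using not_less_Least[of i "\<lambda>i. k \<le> i \<or> \<not> b i"] that by (auto simp: a_def)
  moreover have "\<not> b i" if "a \<le> i" "i < k" for i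
    using that
  proof (induction i rule: dec_induct)
    case (step i)
    show ?case
    proof
      assume "b (Suc i)"
      then have "(p (Suc i), p (Suc (Suc i))) \<in> F" "(p (Suc i), p i) \<in> F"
        using arc[of i] arc[of "Suc i"] step by (auto simp: path_arc_def)
      then have "p (Suc (Suc i)) = p i"
        using F by (auto dest: single_valuedD)
      then show False
        using p step(4) by (auto dest!: inj_onD)
    qed
  qed (use a in auto)
  ultimately show ?thesis
    by (metis not_le)
qed

text \<open>Every ordered pair of vertices of \<open>C\<close> is joined by a counted path, and a
  path determines its ends; hence the square. \<open>G\<close> will be the undirected color class,
  \<open>F\<close> the oriented arcs, and \<open>B k\<close> a set of patterns covering all
  orientations that can occur.\<close>

lemma component_card_le:
  assumes C: "C \<in> components_of_graph n G" and G: "G \<subseteq> F \<union> F\<inverse>" and F: "F \<subseteq> {..<n} \<times> {..<n}"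
    and fin: "\<And>k. finite (B k)"
    and B: "\<And>k p b. \<lbrakk>p \<in> simple_paths n k; \<And>i. i < k \<Longrightarrow> path_arc p b i \<in> F\<rbrakk>
              \<Longrightarrow> \<exists>b'\<in>B k. \<forall>i<k. b' i = b i"
  shows "(card C)\<^sup>2 \<le> card {(k, p, b) \<in> (SIGMA k:{..<n}. simple_paths n k \<times> B k). \<forall>i<k. path_arc p b i \<in> F}"
    (is "_ \<le> card ?P")
proof -
  have fP: "finite ?P"
    by (rule finite_subset[of _ "SIGMA k:{..<n}. simple_paths n k \<times> B k"]) (auto simp: fin)
  obtain u where u: "u < n" "C = connected_in n G `` {u}"
    using C by (auto simp: components_of_graph_def elim: quotientE)
  have "C \<times> C \<subseteq> (\<lambda>(k, p, b). (p 0, p k)) ` ?P"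
  proof (rule subrelI)
    fix v w assume "(v, w) \<in> C \<times> C"
    then have vw: "v < n" "w < n" "(u, v) \<in> (G \<union> G\<inverse>)\<^sup>*" "(u, w) \<in> (G \<union> G\<inverse>)\<^sup>*"
      by (auto simp: u connected_in_def)
    have "sym ((G \<union> G\<inverse>)\<^sup>*)"
      by (intro sym_rtrancl) (auto simp: sym_def)
    then have "(v, w) \<in> (G \<union> G\<inverse>)\<^sup>*"
      using vw(3,4) by (meson rtrancl_trans symD)
    moreover have "(G \<union> G\<inverse>)\<^sup>* \<subseteq> (F \<union> F\<inverse>)\<^sup>*"
      using G by (intro rtrancl_mono) auto
    ultimately have "(v, w) \<in> (F \<union> F\<inverse>)\<^sup>*"
      by auto
    then obtain k p b where p: "k < n" "p \<in> simple_paths n k" "p 0 = v" "p k = w"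
      and arc: "\<And>i. i < k \<Longrightarrow> path_arc p b i \<in> F"
      using connected_imp_oriented_path[OF _ F vw(1)] by metis
    obtain b' where "b' \<in> B k" "\<forall>i<k. b' i = b i"
      using B[OF p(2) arc] by blast
    then have "(k, p, b') \<in> ?P"
      using p arc by (auto simp: path_arc_def)
    then show "(v, w) \<in> (\<lambda>(k, p, b). (p 0, p k)) ` ?P"
      using p by (intro image_eqI[of _ _ "(k, p, b')"]) auto
  qed
  then have "card (C \<times> C) \<le> card ((\<lambda>(k, p, b). (p 0, p k)) ` ?P)"
    by (intro card_mono finite_imageI fP)
  also have "\<dots> \<le> card ?P"
    by (rule card_image_le[OF fP])
  finally show ?thesis
    by (simp add: card_cartesian_product power2_eq_square)
qed

section \<open>Union bound over rounds, for main and overflow colors\<close>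

section \<open>The probability of a fixed path\<close>

text \<open>Union bound over the \<open>T ^ k\<close> assignments \<tau> of rounds to arcs. As the
  arcs are distinct, an assignment that is not injective gives an empty event.\<close>

lemma prob_arcs_le:
  assumes e: "inj_on e {..<k::nat}" and "0 \<le> B"
    and le: "\<And>\<tau>. \<lbrakk>inj_on \<tau> {..<k}; \<tau> ` {..<k} \<subseteq> {..<T}\<rbrakk> \<Longrightarrow>
      measure_pmf.prob N {(x, J). \<forall>i<k. x (\<tau> i) = e i \<and> round_color r J x (\<tau> i) = c} \<le> B"
  shows "measure_pmf.prob N {(x, J). \<forall>i<k. e i \<in> arcs T r J x c} \<le> real T ^ k * B"
proof -
  let ?E = "\<lambda>\<tau>. {(x, J). \<forall>i<k. x (\<tau> i) = e i \<and> round_color r J x (\<tau> i) = c}"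
  let ?I = "{..<k} \<rightarrow>\<^sub>E {..<T}"
  have le': "measure_pmf.prob N (?E \<tau>) \<le> B" if "\<tau> \<in> ?I" for \<tau>
  proof (cases "inj_on \<tau> {..<k}")
    case True
    then show ?thesis
      using that by (intro le) auto
  next
    case False
    then obtain i j where ij: "i < k" "j < k" "i \<noteq> j" "\<tau> i = \<tau> j"
      by (auto simp: inj_on_def)
    have "e i \<noteq> e j"
      using e ij by (auto simp: inj_on_def)
    then have "\<not> (\<forall>l<k. x (\<tau> l) = e l \<and> round_color r J x (\<tau> l) = c)" for x J
      using ij by metis
    then have "?E \<tau> = {}"
      by blast
    then show ?thesis
      using \<open>0 \<le> B\<close> by (simp only: measure_empty)
  qed
  have "{(x, J). \<forall>i<k. e i \<in> arcs T r J x c} \<subseteq> (\<Union>\<tau>\<in>?I. ?E \<tau>)"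
  proof clarify
    fix x J assume "\<forall>i<k. e i \<in> arcs T r J x c"
    then have "\<forall>i. \<exists>t. i < k \<longrightarrow> t < T \<and> x t = e i \<and> round_color r J x t = c"
      unfolding arcs_def mem_Collect_eq by metis
    then obtain \<tau> where "\<And>i. i < k \<Longrightarrow> \<tau> i < T \<and> x (\<tau> i) = e i \<and> round_color r J x (\<tau> i) = c"
      by metis
    then show "(x, J) \<in> (\<Union>\<tau>\<in>?I. ?E \<tau>)"
      by (intro UN_I[of "restrict \<tau> {..<k}"]) auto
  qed
  then have "measure_pmf.prob N {(x, J). \<forall>i<k. e i \<in> arcs T r J x c}
      \<le> measure_pmf.prob N (\<Union>\<tau>\<in>?I. ?E \<tau>)"
    by (intro measure_pmf.finite_measure_mono) auto
  also have "\<dots> \<le> (\<Sum>\<tau>\<in>?I. measure_pmf.prob N (?E \<tau>))"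
    by (intro measure_pmf.finite_measure_subadditive_finite) (auto intro!: finite_PiE)
  also have "\<dots> \<le> (\<Sum>\<tau>\<in>?I. B)"
    by (intro sum_mono le')
  also have "\<dots> = real T ^ k * B"
    by (simp add: card_PiE)
  finally show ?thesis .
qed

lemma prob_shift_eq_le:
  assumes "r > 0"
  shows "measure_pmf.prob (pmf_of_set {..<r :: nat}) {j. (j + m) mod r = c} \<le> 1 / real r"
proof -
  have "card ({..<r} \<inter> {j. (j + m) mod r = c}) \<le> Suc 0"
    using inj_on_add_mod[of m r]
    by (subst card_le_Suc0_iff_eq) (auto simp: inj_on_def add.commute)
  then show ?thesis
    using assms by (simp add: measure_pmf_of_set lessThan_empty_iff divide_right_mono)
qed

definition round_pmf :: "nat \<Rightarrow> nat \<Rightarrow> (nat \<Rightarrow> edge) pmf" where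
  "round_pmf n T = Pi_pmf {..<T} (0, 0) (\<lambda>_. directed_edge_pmf n)"

definition shift_pmf :: "nat \<Rightarrow> nat \<Rightarrow> (nat \<Rightarrow> nat) pmf" where
  "shift_pmf n r = Pi_pmf {..<n} 0 (\<lambda>_. pmf_of_set {..<r})"

context
  fixes n T :: nat
  assumes n: "2 \<le> n"
begin

lemma prob_rounds_le:
  assumes "inj_on \<tau> {..<k}" "\<tau> ` {..<k} \<subseteq> {..<T}"
  shows "measure_pmf.prob (round_pmf n T) {x. \<forall>i<k. x (\<tau> i) = e i} \<le> (1 / (real n * (real n - 1))) ^ k"
proof -
  have "measure_pmf.prob (round_pmf n T) {x. \<forall>i<k. x (\<tau> i) \<in> {e i}}
      = (\<Prod>i<k. measure_pmf.prob (directed_edge_pmf n) {e i})"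
    unfolding round_pmf_def by (rule prob_Pi_pmf_injective[OF _ assms]) simp
  also have "\<dots> \<le> (\<Prod>i<k. 1 / (real n * (real n - 1)))"
    using pmf_directed_edge_pmf_le[OF n] by (intro prod_mono) (auto simp: measure_pmf_single)
  finally show ?thesis
    by simp
qed

text \<open>Given the arrivals, the indices are fixed numbers. The sources are distinct, so their
  shifts are independent, and each yields color \<open>c\<close> with probability at most
  \<open>1 / r\<close>.\<close>

lemma prob_main_color_le:
  assumes r: "0 < r" and c: "c < r"
    and \<tau>: "inj_on \<tau> {..<k}" "\<tau> ` {..<k} \<subseteq> {..<T}"
    and e: "inj_on (\<lambda>i. fst (e i)) {..<k}" "\<And>i. i < k \<Longrightarrow> fst (e i) < n"
  shows "measure_pmf.prob (pair_pmf (round_pmf n T) (shift_pmf n r))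
      {(x, J). \<forall>i<k. x (\<tau> i) = e i \<and> round_color r J x (\<tau> i) = c}
    \<le> (1 / (real n * (real n - 1)) / real r) ^ k"
proof -
  have Q: "measure_pmf.prob (shift_pmf n r) {J. \<forall>i<k. round_color r J x (\<tau> i) = c} \<le> (1 / real r) ^ k"
    if x: "\<forall>i<k. x (\<tau> i) = e i" for x
  proof -
    let ?B = "\<lambda>i. {j. (j + prior x (\<tau> i)) mod r = c}"
    have "measure_pmf.prob (shift_pmf n r) {J. \<forall>i<k. round_color r J x (\<tau> i) = c}
        \<le> measure_pmf.prob (shift_pmf n r) {J. \<forall>i<k. J (fst (e i)) \<in> ?B i}"
      using x c by (intro measure_pmf.finite_measure_mono)
        (auto simp: round_color_def split: if_splits)
    also have "\<dots> = (\<Prod>i<k. measure_pmf.prob (pmf_of_set {..<r}) (?B i))"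
      unfolding shift_pmf_def using e by (intro prob_Pi_pmf_injective) auto
    also have "\<dots> \<le> (\<Prod>i<k. 1 / real r)"
      using prob_shift_eq_le[OF r] by (intro prod_mono) auto
    finally show ?thesis
      by simp
  qed
  have "measure_pmf.prob (pair_pmf (round_pmf n T) (shift_pmf n r))
      {(x, J). (\<forall>i<k. x (\<tau> i) = e i) \<and> (\<forall>i<k. round_color r J x (\<tau> i) = c)}
    \<le> measure_pmf.prob (round_pmf n T) {x. \<forall>i<k. x (\<tau> i) = e i} * (1 / real r) ^ k"
    by (rule prob_pair_pmf_le[OF Q]) auto
  also have "\<dots> \<le> (1 / (real n * (real n - 1))) ^ k * (1 / real r) ^ k"
    by (intro mult_right_mono prob_rounds_le \<tau>) simp
  also have "\<dots> = (1 / (real n * (real n - 1)) / real r) ^ k"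
    by (simp add: power_mult_distrib[symmetric])
  finally show ?thesis
    by (simp add: all_conj_distrib imp_conjR)
qed

text \<open>Every second arc of a simple path has its own source, so a path of \<open>k\<close> overflow arcs forces
  about \<open>k r / 2\<close> further rounds to start in a set of \<open>k / 2\<close> vertices. Markov's inequality for
  \<open>z ^ N\<close>, where \<open>N\<close> counts these rounds, bounds the probability.\<close>

lemma overflow_rounds_ge:
  fixes e :: "nat \<Rightarrow> edge"
  assumes \<tau>: "inj_on \<tau> {..<k}" "\<tau> ` {..<k} \<subseteq> {..<T}"
    and inj: "inj_on (\<lambda>i. fst (e i)) I" and I: "I \<subseteq> {..<k}"
    and x: "\<And>i. i < k \<Longrightarrow> x (\<tau> i) = e i" "\<And>i. i < k \<Longrightarrow> r \<le> prior x (\<tau> i)"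
  shows "card I * Suc r \<le> card {t \<in> {..<T} - \<tau> ` {..<k}. fst (x t) \<in> (\<lambda>i. fst (e i)) ` I} + k"
proof -
  let ?R = "\<lambda>s. {t \<in> {..<T}. fst (x t) = s}" and ?S = "(\<lambda>i. fst (e i)) ` I"
  have finI: "finite I"
    using I by (rule finite_subset) simp
  have "Suc r \<le> card (?R s)" if s: "s \<in> ?S" for s
  proof -
    obtain i where i: "i < k" "s = fst (e i)"
      using s I by blast
    have "insert (\<tau> i) {t. t < \<tau> i \<and> fst (x t) = fst (x (\<tau> i))} \<subseteq> ?R s"
      using \<tau>(2) i x(1)[OF i(1)] by auto
    then have "card (insert (\<tau> i) {t. t < \<tau> i \<and> fst (x t) = fst (x (\<tau> i))}) \<le> card (?R s)"
      by (intro card_mono) auto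
    moreover have "card (insert (\<tau> i) {t. t < \<tau> i \<and> fst (x t) = fst (x (\<tau> i))}) = Suc (prior x (\<tau> i))"
      by (simp add: prior_def)
    ultimately show ?thesis
      using x(2)[OF i(1)] by simp
  qed
  then have "(\<Sum>s\<in>?S. Suc r) \<le> (\<Sum>s\<in>?S. card (?R s))"
    by (rule sum_mono)
  also have "\<dots> = card (\<Union>s\<in>?S. ?R s)"
    using finI by (intro card_UN_disjoint[symmetric]) auto
  \<comment> \<open>The rounds in the image of \<tau> are set aside because their arcs are
    prescribed; this costs at most \<open>k\<close>.\<close>
  also have "\<dots> \<le> card ({t \<in> {..<T} - \<tau> ` {..<k}. fst (x t) \<in> ?S} \<union> \<tau> ` {..<k})"
    by (intro card_mono) auto
  also have "\<dots> \<le> card {t \<in> {..<T} - \<tau> ` {..<k}. fst (x t) \<in> ?S} + card (\<tau> ` {..<k})"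
    by (rule card_Un_le)
  finally show ?thesis
    using \<tau>(1) inj by (simp add: card_image)
qed

lemma prob_overflow_le:
  fixes e :: "nat \<Rightarrow> edge"
  assumes z: "1 \<le> z" and T: "real T \<le> \<rho> * real r * real n"
    and \<alpha>: "\<alpha> = ln z - \<rho> * (z - 1)" "0 \<le> \<alpha>"
    and \<tau>: "inj_on \<tau> {..<k}" "\<tau> ` {..<k} \<subseteq> {..<T}"
    and inj: "inj_on (\<lambda>i. fst (e i)) I" and I: "I \<subseteq> {..<k}" "k \<le> 2 * card I"
  shows "measure_pmf.prob (round_pmf n T) {x. \<forall>i<k. x (\<tau> i) = e i \<and> r \<le> prior x (\<tau> i)}
    \<le> (1 / (real n * (real n - 1)) * (z * exp (- (real r * \<alpha> / 2)))) ^ k" (is "measure_pmf.prob _ ?A \<le> _")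
proof -
  define q where "q = 1 / (real n * (real n - 1))"
  define S where "S = (\<lambda>i. fst (e i)) ` I"
  define m where "m = card I"
  \<comment> \<open>The product of \<open>W t (x t)\<close> over all rounds is the indicator of the
    prescribed arcs times \<open>z ^ N\<close>, with \<open>N\<close> the number of other rounds
    that start in \<open>S\<close>. Each factor reads one round only, so the expectation
    factorizes.\<close>
  define W where "W t y = of_bool (\<forall>i<k. \<tau> i = t \<longrightarrow> y = e i)
      * (if t \<notin> \<tau> ` {..<k} \<and> fst y \<in> S then z else 1)" for t and y :: edge
  have finI: "finite I"
    using I(1) by (rule finite_subset) simp
  then have finS: "finite S" and cardS: "card S = m"
    using inj by (simp_all add: S_def m_def card_image)
  have W_bound: "0 \<le> W t y" "W t y \<le> z" for t y
    using z by (auto simp: W_def)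
  have W_int: "integrable (measure_pmf (directed_edge_pmf n)) (W t)" for t
    using W_bound by (intro measure_pmf.integrable_const_bound[where B = z]) auto
  have prod_int: "integrable (measure_pmf (round_pmf n T)) (\<lambda>x. \<Prod>t<T. W t (x t))"
    unfolding round_pmf_def by (intro integrable_prod_Pi_pmf W_int) auto
  \<comment> \<open>The factor \<open>z ^ k\<close> pays for the summand \<open>k\<close> in
    \<open>overflow_rounds_ge\<close>.\<close>
  have pointwise: "z ^ (m * Suc r) \<le> z ^ k * (\<Prod>t<T. W t (x t))" if x: "x \<in> ?A" for x
  proof -
    let ?N = "{t \<in> {..<T} - \<tau> ` {..<k}. fst (x t) \<in> S}"
    have "W t (x t) = (if t \<in> ?N then z else 1)" if "t < T" for t
      using x that by (auto simp: W_def)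
    then have "(\<Prod>t<T. W t (x t)) = (\<Prod>t<T. if t \<in> ?N then z else 1)"
      by (intro prod.cong) auto
    also have "\<dots> = z ^ card ?N"
      by (simp add: prod.If_cases Int_def conj_ac)
    finally have "z ^ k * (\<Prod>t<T. W t (x t)) = z ^ (card ?N + k)"
      by (simp add: power_add)
    moreover have "m * Suc r \<le> card ?N + k"
      unfolding m_def S_def using x by (intro overflow_rounds_ge \<tau> inj I) auto
    ultimately show ?thesis
      using z by (simp add: power_increasing)
  qed
  have E1: "measure_pmf.expectation (directed_edge_pmf n) (W t) \<le> q" if t: "t \<in> \<tau> ` {..<k}" for t
  proof -
    obtain i where i: "i < k" "t = \<tau> i"
      using t by auto
    have "measure_pmf.expectation (directed_edge_pmf n) (W t)
        \<le> measure_pmf.expectation (directed_edge_pmf n) (indicator {e i})"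
      using i by (intro integral_mono W_int measure_pmf.integrable_const_bound[where B = 1]) (auto simp: W_def)
    also have "\<dots> \<le> q"
      using pmf_directed_edge_pmf_le[OF n] by (simp add: measure_pmf_single q_def)
    finally show ?thesis .
  qed
  have E2: "measure_pmf.expectation (directed_edge_pmf n) (W t) \<le> 1 + (z - 1) * (real m / real n)"
    if "t \<notin> \<tau> ` {..<k}" for t
  proof -
    have "W t = (\<lambda>y. 1 + (z - 1) * indicator {e. fst e \<in> S} y)"
      using that by (auto simp: W_def fun_eq_iff)
    then have "measure_pmf.expectation (directed_edge_pmf n) (W t)
        = 1 + (z - 1) * measure_pmf.prob (directed_edge_pmf n) {e. fst e \<in> S}"
      by (simp add: measure_pmf.integrable_const_bound[where B = 1])
    also have "\<dots> \<le> 1 + (z - 1) * (real m / real n)"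
      using prob_directed_edge_source_le[OF n finS] z
      by (intro add_left_mono mult_left_mono) (simp_all add: cardS)
    finally show ?thesis .
  qed
  have q0: "0 \<le> q"
    using n by (simp add: q_def)
  have ge1: "1 \<le> 1 + (z - 1) * (real m / real n)"
    using z by simp
  have "measure_pmf.prob (round_pmf n T) ?A * z ^ (m * Suc r)
      = measure_pmf.expectation (round_pmf n T) (\<lambda>x. z ^ (m * Suc r) * indicator ?A x)"
    by simp
  also have "\<dots> \<le> measure_pmf.expectation (round_pmf n T) (\<lambda>x. z ^ k * (\<Prod>t<T. W t (x t)))"
  proof (rule integral_mono)
    show "integrable (measure_pmf (round_pmf n T)) (\<lambda>x. z ^ (m * Suc r) * indicator ?A x)"
      by (intro integrable_mult_right measure_pmf.integrable_const_bound[where B = 1]) auto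
    show "integrable (measure_pmf (round_pmf n T)) (\<lambda>x. z ^ k * (\<Prod>t<T. W t (x t)))"
      by (intro integrable_mult_right prod_int)
    show "z ^ (m * Suc r) * indicator ?A x \<le> z ^ k * (\<Prod>t<T. W t (x t))" for x
    proof (cases "x \<in> ?A")
      case False
      then show ?thesis
        using z W_bound by (simp add: prod_nonneg)
    qed (use pointwise[of x] in simp)
  qed
  also have "\<dots> = z ^ k * (\<Prod>t<T. measure_pmf.expectation (directed_edge_pmf n) (W t))"
    unfolding round_pmf_def using W_bound
    by (simp add: expectation_prod_Pi_pmf W_int)
  also have "(\<Prod>t<T. measure_pmf.expectation (directed_edge_pmf n) (W t))
      = (\<Prod>t\<in>\<tau> ` {..<k}. measure_pmf.expectation (directed_edge_pmf n) (W t))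
      * (\<Prod>t\<in>{..<T} - \<tau> ` {..<k}. measure_pmf.expectation (directed_edge_pmf n) (W t))"
    using \<tau>(2) by (subst prod.subset_diff[of "\<tau> ` {..<k}"]) (auto simp: mult.commute)
  also have "\<dots> \<le> (\<Prod>t\<in>\<tau> ` {..<k}. q) * (\<Prod>t\<in>{..<T} - \<tau> ` {..<k}. 1 + (z - 1) * (real m / real n))"
    using E1 E2 W_bound q0
    by (intro mult_mono prod_mono prod_nonneg) (auto intro!: integral_nonneg)
  also have "\<dots> \<le> q ^ k * (1 + (z - 1) * (real m / real n)) ^ T"
  proof (rule mult_mono)
    have "card ({..<T} - \<tau> ` {..<k}) \<le> card {..<T}"
      by (intro card_mono) auto
    then show "(\<Prod>t\<in>{..<T} - \<tau> ` {..<k}. 1 + (z - 1) * (real m / real n))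
        \<le> (1 + (z - 1) * (real m / real n)) ^ T"
      using ge1 by (simp add: power_increasing)
  qed (use q0 ge1 \<tau>(1) in \<open>auto simp: card_image intro!: prod_nonneg\<close>)
  also have "(1 + (z - 1) * (real m / real n)) ^ T \<le> exp (real m * real r * (\<rho> * (z - 1)))"
  proof -
    have "(1 + (z - 1) * (real m / real n)) ^ T \<le> exp ((z - 1) * (real m / real n)) ^ T"
      using ge1 by (intro power_mono exp_ge_add_one_self) auto
    also have "\<dots> = exp (real T * ((z - 1) * (real m / real n)))"
      by (rule exp_of_nat_mult[symmetric])
    also have "real T * ((z - 1) * (real m / real n))
        \<le> \<rho> * real r * real n * ((z - 1) * (real m / real n))"
      using z T by (intro mult_right_mono) auto
    also have "\<dots> = real m * real r * (\<rho> * (z - 1))"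
      using n by simp
    finally show ?thesis
      by simp
  qed
  finally have "measure_pmf.prob (round_pmf n T) ?A * z ^ (m * Suc r)
      \<le> z ^ k * (q ^ k * exp (real m * real r * (\<rho> * (z - 1))))"
    using z q0 by (simp add: mult_left_mono)
  moreover have "exp (real m * real r * ln z) \<le> z ^ (m * Suc r)"
  proof -
    have "exp (real m * real r * ln z) = z ^ (m * r)"
      using z by (simp only: exp_of_nat_mult exp_ln flip: of_nat_mult)
    also have "\<dots> \<le> z ^ (m * Suc r)"
      using z by (intro power_increasing) auto
    finally show ?thesis .
  qed
  ultimately have "measure_pmf.prob (round_pmf n T) ?A * exp (real m * real r * ln z)
      \<le> z ^ k * (q ^ k * exp (real m * real r * (\<rho> * (z - 1))))"
    by (meson mult_left_mono measure_nonneg order_trans)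
  then have "measure_pmf.prob (round_pmf n T) ?A
      \<le> z ^ k * (q ^ k * exp (real m * real r * (\<rho> * (z - 1)))) * exp (- (real m * real r * ln z))"
    by (simp add: exp_minus field_simps)
  also have "\<dots> = z ^ k * q ^ k * exp (- (real m * (real r * \<alpha>)))"
    by (simp add: \<alpha>(1) algebra_simps flip: exp_add)
  \<comment> \<open>Since \<open>card I\<close> is only known to be at least \<open>k / 2\<close>,
    half of the exponent is given away here.\<close>
  also have "\<dots> \<le> z ^ k * q ^ k * exp (- (real k * (real r * \<alpha> / 2)))"
  proof -
    have "real k / 2 * (real r * \<alpha>) \<le> real m * (real r * \<alpha>)"
      using I(2) \<alpha>(2) by (intro mult_right_mono) (auto simp: m_def)
    then show ?thesis
      using z q0 by (intro mult_left_mono) auto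
  qed
  also have "\<dots> = (q * (z * exp (- (real r * \<alpha> / 2)))) ^ k"
    by (simp add: power_mult_distrib flip: exp_of_nat_mult)
  finally show ?thesis
    unfolding q_def .
qed

end

section \<open>First-moment bounds for component sizes\<close>

section \<open>Component sizes\<close>

text \<open>Ranging over all subgraphs \<open>G\<close> covers the algorithm's color class, which
  keeps first arrivals only and forgets directions.\<close>

definition has_component_larger :: "nat \<Rightarrow> real \<Rightarrow> edge set \<Rightarrow> bool" where
  "has_component_larger n s F \<longleftrightarrow>
    (\<exists>G C. G \<subseteq> F \<union> F\<inverse> \<and> C \<in> components_of_graph n G \<and> s < real (card C))"

lemma fst_path_arc: "fst (path_arc p b i) = p (if b i then i else Suc i)"
  by (simp add: path_arc_def)

text \<open>The vertex \<open>p i\<close> is an end of arc \<open>i\<close> but of no arc with a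
  larger index.\<close>

lemma inj_on_path_arc:
  assumes p: "inj_on p {..k}"
  shows "inj_on (path_arc p b) {..<k}"
proof (rule linorder_inj_onI)
  fix i j assume ij: "i < j" "i \<in> {..<k}" "j \<in> {..<k}"
  then have "p i \<noteq> p j" "p i \<noteq> p (Suc j)"
    by (simp_all add: inj_on_eq_iff[OF p])
  then show "path_arc p b i \<noteq> path_arc p b j"
    by (auto simp: path_arc_def split: if_splits)
qed auto

context
  fixes n T r :: nat and \<rho> :: real
  assumes n: "2 \<le> n" and r: "0 < r" and \<rho>: "0 < \<rho>" "\<rho> < 1"
    and T: "real T \<le> \<rho> * real r * (real n - 1)"
begin

abbreviation "process \<equiv> pair_pmf (round_pmf n T) (shift_pmf n r)"

text \<open>For each \<open>k\<close> there are at most \<open>n ^ (k + 1)\<close> paths with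
  \<open>w k\<close> patterns, each present with probability at most \<open>\<beta> ^ k\<close>. A
  component larger than \<open>s\<close> forces \<open>s\<^sup>2\<close> of them to be present, and
  Markov's inequality applies.\<close>

lemma prob_component_larger_le:
  assumes s: "0 \<le> s" and fin: "\<And>k. finite (B k)" and w: "\<And>k. real (card (B k)) \<le> w k" and \<beta>: "0 \<le> \<beta>"
    and cover: "\<And>x J k p b. \<lbrakk>p \<in> simple_paths n k; \<And>i. i < k \<Longrightarrow> path_arc p b i \<in> arcs T r J x c\<rbrakk>
              \<Longrightarrow> \<exists>b'\<in>B k. \<forall>i<k. b' i = b i"
    and prob: "\<And>k p b. \<lbrakk>p \<in> simple_paths n k; b \<in> B k\<rbrakk> \<Longrightarrow>
      measure_pmf.prob process {(x, J). \<forall>i<k. path_arc p b i \<in> arcs T r J x c} \<le> \<beta> ^ k"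
  shows "s\<^sup>2 * measure_pmf.prob process {(x, J). has_component_larger n s (arcs T r J x c)}
    \<le> real n * (\<Sum>k<n. w k * (real n * \<beta>) ^ k)"
proof -
  let ?C = "SIGMA k:{..<n}. simple_paths n k \<times> B k"
  let ?Q = "\<lambda>(k, p, b) (x, J). \<forall>i<k. path_arc p b i \<in> arcs T r J x c"
  have finC: "finite ?C"
    by (auto simp: fin)
  have large: "s\<^sup>2 \<le> real (card {q \<in> ?C. ?Q q (x, J)})"
    if x: "x \<in> set_pmf (round_pmf n T)" and C: "has_component_larger n s (arcs T r J x c)" for x J
  proof -
    have "x t \<in> {..<n} \<times> {..<n}" if "t < T" for t
    proof -
      have "x t \<in> set_pmf (directed_edge_pmf n)"
        using x that set_Pi_pmf_subset'[of "{..<T}" "(0, 0)" "\<lambda>_. directed_edge_pmf n"]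
        by (auto simp: round_pmf_def PiE_dflt_def)
      then show ?thesis
        using set_directed_edge_pmf[OF n] by auto
    qed
    then have F: "arcs T r J x c \<subseteq> {..<n} \<times> {..<n}"
      unfolding arcs_def by blast
    obtain G K where G: "G \<subseteq> arcs T r J x c \<union> (arcs T r J x c)\<inverse>"
      and K: "K \<in> components_of_graph n G" and sK: "s < real (card K)"
      using C unfolding has_component_larger_def by blast
    have "s\<^sup>2 \<le> (real (card K))\<^sup>2"
      using s sK by (intro power_mono) auto
    also have "\<dots> = real ((card K)\<^sup>2)"
      by simp
    also have "(card K)\<^sup>2 \<le> card {(k, p, b) \<in> ?C. \<forall>i<k. path_arc p b i \<in> arcs T r J x c}"
      by (rule component_card_le[OF K G F fin cover])
    also have "{(k, p, b) \<in> ?C. \<forall>i<k. path_arc p b i \<in> arcs T r J x c} = {q \<in> ?C. ?Q q (x, J)}"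
      by auto
    finally show ?thesis
      by simp
  qed
  have "measure_pmf.prob process {(x, J). has_component_larger n s (arcs T r J x c)}
      \<le> measure_pmf.prob process {y. s\<^sup>2 \<le> real (card {q \<in> ?C. ?Q q y})}"
    using large by (intro measure_pmf.finite_measure_mono_AE) (auto simp: AE_measure_pmf_iff)
  then have "s\<^sup>2 * measure_pmf.prob process {(x, J). has_component_larger n s (arcs T r J x c)}
      \<le> s\<^sup>2 * measure_pmf.prob process {y. s\<^sup>2 \<le> real (card {q \<in> ?C. ?Q q y})}"
    by (rule mult_left_mono) simp
  also have "\<dots> \<le> (\<Sum>q\<in>?C. measure_pmf.prob process {y. ?Q q y})"
    by (rule markov_count[OF finC])
  also have "\<dots> \<le> (\<Sum>(k, pb)\<in>?C. \<beta> ^ k)"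
    using prob by (intro sum_mono) (auto simp: case_prod_unfold)
  also have "\<dots> = (\<Sum>k<n. \<Sum>pb\<in>simple_paths n k \<times> B k. \<beta> ^ k)"
    using fin by (subst sum.Sigma) auto
  also have "\<dots> = (\<Sum>k<n. real (card (simple_paths n k)) * real (card (B k)) * \<beta> ^ k)"
    by (simp add: card_cartesian_product)
  also have "\<dots> \<le> (\<Sum>k<n. real n ^ Suc k * w k * \<beta> ^ k)"
  proof (intro sum_mono mult_right_mono mult_mono w)
    show "real (card (simple_paths n k)) \<le> real n ^ Suc k" for k
      using card_simple_paths_le[of n k] by (metis of_nat_le_iff of_nat_power)
  qed (use \<beta> in auto)
  also have "\<dots> = real n * (\<Sum>k<n. w k * (real n * \<beta>) ^ k)"
    by (simp add: sum_distrib_left power_mult_distrib mult_ac)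
  finally show ?thesis .
qed

text \<open>Out-degree at most one leaves only the \<open>k + 1\<close> patterns of forward steps
  followed by backward ones. The sum is therefore a differentiated geometric series of ratio \<rho>,
  where all \<open>2 ^ k\<close> patterns would give ratio \<open>2 * \<rho>\<close>.\<close>

lemma prob_main_component_le:
  assumes c: "c < r" and s: "0 \<le> s"
  shows "s\<^sup>2 * measure_pmf.prob process {(x, J). has_component_larger n s (arcs T r J x c)}
    \<le> real n / (1 - \<rho>)\<^sup>2"
proof -
  define B where "B k = (\<lambda>a i. i < a) ` {..k}" for k :: nat
  define q where "q = 1 / (real n * (real n - 1)) / real r"
  have q0: "0 \<le> q"
    using n by (simp add: q_def)
  have "s\<^sup>2 * measure_pmf.prob process {(x, J). has_component_larger n s (arcs T r J x c)}
      \<le> real n * (\<Sum>k<n. real (Suc k) * (real n * (real T * q)) ^ k)"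
  proof (rule prob_component_larger_le[OF s])
    show "finite (B k)" for k
      by (simp add: B_def)
    show "real (card (B k)) \<le> real (Suc k)" for k
      using card_image_le[of "{..k}" "\<lambda>a i. i < a"] by (simp add: B_def)
    show "0 \<le> real T * q"
      using q0 by simp
    show "\<exists>b'\<in>B k. \<forall>i<k. b' i = b i"
      if p: "p \<in> simple_paths n k" and arc: "\<And>i. i < k \<Longrightarrow> path_arc p b i \<in> arcs T r J x c" for x J k p b
    proof -
      have "inj_on p {..k}"
        using p by (simp add: simple_paths_def)
      then obtain a where "a \<le> k" "\<forall>i<k. b i \<longleftrightarrow> i < a"
        using single_valued_path_orientation[OF single_valued_arcs[OF c] _ arc] by blast
      then show ?thesis
        by (auto simp: B_def)
    qed
    show "measure_pmf.prob process {(x, J). \<forall>i<k. path_arc p b i \<in> arcs T r J x c} \<le> (real T * q) ^ k"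
      if p: "p \<in> simple_paths n k" and b: "b \<in> B k" for k p b
    proof -
      have inj: "inj_on p {..k}" and pn: "\<And>i. i \<le> k \<Longrightarrow> p i < n"
        using p by (auto simp: simple_paths_def)
      obtain a where a: "b = (\<lambda>i. i < a)" "a \<le> k"
        using b by (auto simp: B_def)
      \<comment> \<open>Arcs with \<open>i < a\<close> leave \<open>p i\<close>, the others
        \<open>p (Suc i)\<close>: the sources are all path vertices except
        \<open>p a\<close>.\<close>
      have src: "inj_on (\<lambda>i. fst (path_arc p b i)) {..<k}"
      proof (rule inj_onI)
        fix i j assume ij: "i \<in> {..<k}" "j \<in> {..<k}" "fst (path_arc p b i) = fst (path_arc p b j)"
        then have "(if i < a then i else Suc i) = (if j < a then j else Suc j)"
          by - (rule inj_onD[OF inj], auto simp: fst_path_arc a)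
        then show "i = j"
          by (auto split: if_splits)
      qed
      have "measure_pmf.prob process {(x, J). \<forall>i<k. path_arc p b i \<in> arcs T r J x c} \<le> real T ^ k * q ^ k"
      proof (rule prob_arcs_le)
        show "measure_pmf.prob process {(x, J). \<forall>i<k. x (\<tau> i) = path_arc p b i \<and> round_color r J x (\<tau> i) = c}
            \<le> q ^ k" if "inj_on \<tau> {..<k}" "\<tau> ` {..<k} \<subseteq> {..<T}" for \<tau>
          unfolding q_def using that pn
          by (intro prob_main_color_le n r c src) (auto simp: fst_path_arc)
      qed (use inj q0 in \<open>auto intro: inj_on_path_arc\<close>)
      then show ?thesis
        by (simp add: power_mult_distrib)
    qed
  qed
  also have "\<dots> \<le> real n * (\<Sum>k<n. real (Suc k) * \<rho> ^ k)"
  proof (intro mult_left_mono sum_mono power_mono)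
    \<comment> \<open>The factor \<open>n - 1\<close> in the bound on \<open>T\<close> cancels the
      one left over from the arc probability \<open>1 / (n (n - 1))\<close>.\<close>
    have "real n * (real T * q) = real T / ((real n - 1) * real r)"
      using n by (simp add: q_def)
    also have "\<dots> \<le> \<rho>"
      using T n r by (simp add: divide_le_eq mult_ac)
    finally show "real n * (real T * q) \<le> \<rho>" .
  qed (use q0 in auto)
  also have "\<dots> \<le> real n * (1 / (1 - \<rho>)\<^sup>2)"
  proof (intro mult_left_mono)
    have sums: "(\<lambda>k. real (Suc k) * \<rho> ^ k) sums (1 / (1 - \<rho>)\<^sup>2)"
      using geometric_deriv_sums[of \<rho>] \<rho> by simp
    show "(\<Sum>k<n. real (Suc k) * \<rho> ^ k) \<le> 1 / (1 - \<rho>)\<^sup>2"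
      using sum_le_suminf[OF sums_summable[OF sums], of "{..<n}"] sums_unique[OF sums] \<rho> by simp
  qed simp
  finally show ?thesis
    by simp
qed

text \<open>In the overflow color all \<open>2 ^ k\<close> orientations must be counted; the factor
  exponentially small in \<open>r\<close> absorbs this.\<close>

lemma prob_overflow_component_le:
  assumes s: "0 \<le> s" and \<alpha>: "\<alpha> = ln (1 / \<rho>) - (1 - \<rho>)" "0 \<le> \<alpha>"
    and small: "real r * exp (- (real r * \<alpha> / 2)) \<le> 1 / 4"
  shows "s\<^sup>2 * measure_pmf.prob process {(x, J). has_component_larger n s (arcs T r J x r)}
    \<le> 2 * real n"
proof -
  define B where "B k = {..<k} \<rightarrow>\<^sub>E (UNIV :: bool set)" for k :: nat
  define q where "q = 1 / (real n * (real n - 1)) * (1 / \<rho> * exp (- (real r * \<alpha> / 2)))"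
  have q0: "0 \<le> q"
    using n \<rho> by (simp add: q_def)
  have "s\<^sup>2 * measure_pmf.prob process {(x, J). has_component_larger n s (arcs T r J x r)}
      \<le> real n * (\<Sum>k<n. 2 ^ k * (real n * (real T * q)) ^ k)"
  proof (rule prob_component_larger_le[OF s])
    show "finite (B k)" for k
      by (auto simp: B_def intro!: finite_PiE)
    show "real (card (B k)) \<le> 2 ^ k" for k
      by (simp add: B_def card_PiE)
    show "0 \<le> real T * q"
      using q0 by simp
    show "\<exists>b'\<in>B k. \<forall>i<k. b' i = b i" for k b
      by (rule bexI[of _ "restrict b {..<k}"]) (auto simp: B_def)
    show "measure_pmf.prob process {(x, J). \<forall>i<k. path_arc p b i \<in> arcs T r J x r} \<le> (real T * q) ^ k"
      if p: "p \<in> simple_paths n k" for k p b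
    proof -
      have inj: "inj_on p {..k}"
        using p by (auto simp: simple_paths_def)
      \<comment> \<open>Arc \<open>i\<close> has source \<open>p i\<close> or
        \<open>p (Suc i)\<close>. For distinct even \<open>i\<close> these pairs are disjoint, and
        \<open>(k + 1) div 2\<close> even indices lie below \<open>k\<close>.\<close>
      define I where "I = (\<lambda>j. 2 * j) ` {..<(k + 1) div 2}"
      have I: "I \<subseteq> {..<k}"
        by (auto simp: I_def)
      have cardI: "k \<le> 2 * card I"
        unfolding I_def by (subst card_image) (auto simp: inj_on_def)
      have src: "inj_on (\<lambda>i. fst (path_arc p b i)) I"
      proof (rule inj_onI)
        fix i j assume ij: "i \<in> I" "j \<in> I" "fst (path_arc p b i) = fst (path_arc p b j)"
        then have "(if b i then i else Suc i) = (if b j then j else Suc j)"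
          using I by - (rule inj_onD[OF inj], auto simp: fst_path_arc)
        with ij(1,2) show "i = j"
          by (auto simp: I_def split: if_splits; presburger)
      qed
      have "measure_pmf.prob process {(x, J). \<forall>i<k. path_arc p b i \<in> arcs T r J x r} \<le> real T ^ k * q ^ k"
      proof (rule prob_arcs_le)
        show "measure_pmf.prob process {(x, J). \<forall>i<k. x (\<tau> i) = path_arc p b i \<and> round_color r J x (\<tau> i) = r}
            \<le> q ^ k" if \<tau>: "inj_on \<tau> {..<k}" "\<tau> ` {..<k} \<subseteq> {..<T}" for \<tau>
        proof -
          have color: "r \<le> prior x t" if "round_color r J x t = r" for x J t
          proof (rule ccontr)
            assume "\<not> r \<le> prior x t"
            then have "round_color r J x t < r"
              using r by (simp add: round_color_def)
            with that show False
              by simp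
          qed
          have "measure_pmf.prob process {(x, J). \<forall>i<k. x (\<tau> i) = path_arc p b i \<and> round_color r J x (\<tau> i) = r}
              \<le> measure_pmf.prob process
                  {(x, J). (\<forall>i<k. x (\<tau> i) = path_arc p b i \<and> r \<le> prior x (\<tau> i)) \<and> True}"
            using color by (intro measure_pmf.finite_measure_mono) auto
          \<comment> \<open>The shifts are discarded: the condition on \<open>J\<close> is
            \<open>True\<close>, bounded by 1.\<close>
          also have "\<dots> \<le> measure_pmf.prob (round_pmf n T)
              {x. \<forall>i<k. x (\<tau> i) = path_arc p b i \<and> r \<le> prior x (\<tau> i)} * 1"
            by (rule prob_pair_pmf_le) simp_all
          also have "\<dots> \<le> q ^ k"
            unfolding q_def mult_1_right
          proof (rule prob_overflow_le[OF n _ _ _ \<alpha>(2) \<tau> src I cardI])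
            \<comment> \<open>The choice \<open>z = 1 / \<rho>\<close> maximizes
              \<open>ln z - \<rho> * (z - 1)\<close>.\<close>
            show "1 \<le> 1 / \<rho>"
              using \<rho> by simp
            show "\<alpha> = ln (1 / \<rho>) - \<rho> * (1 / \<rho> - 1)"
              using \<rho> by (simp add: \<alpha>(1) field_simps)
            have "\<rho> * real r * (real n - 1) \<le> \<rho> * real r * real n"
              using \<rho> by (intro mult_left_mono) auto
            then show "real T \<le> \<rho> * real r * real n"
              using T by simp
          qed
          finally show ?thesis .
        qed
      qed (use inj q0 in \<open>auto intro: inj_on_path_arc\<close>)
      then show ?thesis
        by (simp add: power_mult_distrib)
    qed
  qed
  also have "\<dots> \<le> real n * (\<Sum>k<n. (1 / 2) ^ k)"
  proof (intro mult_left_mono sum_mono)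
    \<comment> \<open>The factor \<open>z = 1 / \<rho>\<close> cancels the \<rho> in the bound on
      \<open>T\<close>; the constant \<open>1 / 4\<close> leaves ratio \<open>1 / 2\<close> after
      doubling for the two orientations.\<close>
    have "real n * (real T * q) = real T / (real n - 1) / \<rho> * exp (- (real r * \<alpha> / 2))"
      using n by (simp add: q_def)
    also have "\<dots> \<le> real r * exp (- (real r * \<alpha> / 2))"
      using T n \<rho> by (intro mult_right_mono) (simp_all add: field_simps)
    finally have "2 * (real n * (real T * q)) \<le> 1 / 2"
      using small by simp
    then have "(2 * (real n * (real T * q))) ^ k \<le> (1 / 2) ^ k" for k
      using q0 by (intro power_mono) auto
    then show "2 ^ k * (real n * (real T * q)) ^ k \<le> (1 / 2) ^ k" for k
      by (simp add: power_mult_distrib)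
  qed simp
  also have "\<dots> \<le> real n * 2"
    by (intro mult_left_mono) (simp_all add: sum_gp_strict)
  finally show ?thesis
    by (simp add: mult.commute)
qed

lemma prob_any_component_le:
  assumes s: "0 < s" and \<alpha>: "\<alpha> = ln (1 / \<rho>) - (1 - \<rho>)" "0 \<le> \<alpha>"
    and small: "real r * exp (- (real r * \<alpha> / 2)) \<le> 1 / 4"
  shows "measure_pmf.prob process {(x, J). \<exists>c\<le>r. has_component_larger n s (arcs T r J x c)}
    \<le> (real r / (1 - \<rho>)\<^sup>2 + 2) * real n / s\<^sup>2"
proof -
  let ?E = "\<lambda>c. {(x, J). has_component_larger n s (arcs T r J x c)}"
  have "{(x, J). \<exists>c\<le>r. has_component_larger n s (arcs T r J x c)} = (\<Union>c\<in>{..r}. ?E c)"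
    by auto
  then have "measure_pmf.prob process {(x, J). \<exists>c\<le>r. has_component_larger n s (arcs T r J x c)}
      \<le> (\<Sum>c\<le>r. measure_pmf.prob process (?E c))"
    by (auto intro!: measure_pmf.finite_measure_subadditive_finite)
  then have "s\<^sup>2 * measure_pmf.prob process {(x, J). \<exists>c\<le>r. has_component_larger n s (arcs T r J x c)}
      \<le> (\<Sum>c\<le>r. s\<^sup>2 * measure_pmf.prob process (?E c))"
    using s by (simp flip: sum_distrib_left)
  also have "\<dots> = (\<Sum>c<r. s\<^sup>2 * measure_pmf.prob process (?E c)) + s\<^sup>2 * measure_pmf.prob process (?E r)"
    by (simp flip: lessThan_Suc_atMost)
  also have "\<dots> \<le> (\<Sum>c<r. real n / (1 - \<rho>)\<^sup>2) + 2 * real n"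
    using s by (intro add_mono sum_mono prob_main_component_le prob_overflow_component_le[OF _ \<alpha> small]) auto
  also have "\<dots> = (real r / (1 - \<rho>)\<^sup>2 + 2) * real n"
    by (simp add: field_simps)
  finally show ?thesis
    using s by (simp add: field_simps)
qed

end

section \<open>The online rule, its coupling with the oriented process, and fixed seeds\<close>

section \<open>The online algorithm\<close>

text \<open>The online property, which lets the history replace the full sequence of
  arrivals.\<close>

lemma round_color_cong:
  assumes "\<And>i. i \<le> t \<Longrightarrow> x i = y i"
  shows "round_color r J x t = round_color r J y t"
proof -
  have "{i. i < t \<and> fst (x i) = fst (x t)} = {i. i < t \<and> fst (y i) = fst (y t)}"
    using assms by auto
  then show ?thesis
    using assms[of t] by (simp add: round_color_def prior_def)
qed

lemma round_color_le: "0 < r \<Longrightarrow> round_color r J x t \<le> r"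
  by (auto simp: round_color_def intro: less_imp_le)

definition orient :: "bool \<Rightarrow> edge \<Rightarrow> edge" where
  "orient b e = (if b then e else prod.swap e)"

text \<open>Orientations belong to rounds rather than edges, so \<open>past @ [e]\<close> suffices
  to rebuild the arcs seen so far; the current round has index \<open>length past\<close>.\<close>

definition seeded_alg :: "nat \<Rightarrow> (nat \<Rightarrow> bool) \<Rightarrow> (nat \<Rightarrow> nat) \<Rightarrow> online_alg" where
  "seeded_alg r b J \<omega> past e = round_color r J (\<lambda>i. orient (b i) ((past @ [e]) ! i)) (length past)"

lemma color_class_seeded_alg:
  fixes b J g T r c
  defines "F \<equiv> arcs T r J (\<lambda>t. orient (b t) (g t)) c"
  shows "color_class (seeded_alg r b J) \<omega> (map g [0..<T]) c \<subseteq> F \<union> F\<inverse>"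
proof
  fix e assume "e \<in> color_class (seeded_alg r b J) \<omega> (map g [0..<T]) c"
  then obtain t where t: "t < T" "e = g t"
    and c: "seeded_alg r b J \<omega> (take t (map g [0..<T])) (g t) = c"
    by (auto simp: color_class_def)
  have "(take t (map g [0..<T]) @ [g t]) ! i = g i" if "i \<le> t" for i
    using that t(1) by (auto simp: nth_append)
  then have "round_color r J (\<lambda>i. orient (b i) ((take t (map g [0..<T]) @ [g t]) ! i)) t
      = round_color r J (\<lambda>t. orient (b t) (g t)) t"
    by (intro round_color_cong) simp
  then have "round_color r J (\<lambda>t. orient (b t) (g t)) t = c"
    using c t(1) by (simp add: seeded_alg_def)
  then have "orient (b t) (g t) \<in> F"
    using t(1) unfolding F_def arcs_def by blast
  then show "e \<in> F \<union> F\<inverse>"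
    by (cases "g t") (auto simp: t(2) orient_def split: if_splits)
qed

text \<open>The coupling that transfers bounds for random arcs to the actual arrivals with
  independent orientation coins.\<close>

lemma oriented_process_eq:
  "map_pmf (\<lambda>(g, b, J). (\<lambda>t. orient (b t) (g t), J))
     (pair_pmf (Pi_pmf {..<T} (0, 0) (\<lambda>_. pmf_of_set (edges n)))
       (pair_pmf (Pi_pmf {..<T} False (\<lambda>_. bernoulli_pmf (1/2))) S))
   = pair_pmf (round_pmf n T) S"
proof -
  let ?G = "Pi_pmf {..<T} (0, 0) (\<lambda>_. pmf_of_set (edges n))"
  let ?O = "Pi_pmf {..<T} False (\<lambda>_. bernoulli_pmf (1/2))"
  have "round_pmf n T = Pi_pmf {..<T} (0, 0)
      (\<lambda>_. map_pmf (\<lambda>(e, b). orient b e) (pair_pmf (pmf_of_set (edges n)) (bernoulli_pmf (1/2))))"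
    by (simp add: round_pmf_def directed_edge_pmf_def orient_def)
  also have "\<dots> = map_pmf (\<lambda>h. (\<lambda>(e, b). orient b e) \<circ> h)
      (Pi_pmf {..<T} ((0, 0), False) (\<lambda>_. pair_pmf (pmf_of_set (edges n)) (bernoulli_pmf (1/2))))"
    by (rule Pi_pmf_map) (simp_all add: orient_def)
  also have "\<dots> = map_pmf (\<lambda>(g, b) t. orient (b t) (g t)) (pair_pmf ?G ?O)"
    by (simp add: Pi_pmf_pair[symmetric] pmf.map_comp comp_def case_prod_unfold)
  finally have round: "round_pmf n T = map_pmf (\<lambda>(g, b) t. orient (b t) (g t)) (pair_pmf ?G ?O)" .
  show ?thesis
    unfolding round pair_map_pmf1 pair_pair_pmf
    by (simp add: pmf.map_comp comp_def case_prod_unfold apfst_def map_prod_def)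
qed

lemma exists_seeds_prob_less:
  assumes "measure_pmf.prob (pair_pmf (round_pmf n T) S) {(x, J). Q x J} < \<beta>"
  shows "\<exists>b J. measure_pmf.prob (Pi_pmf {..<T} (0, 0) (\<lambda>_. pmf_of_set (edges n)))
      {g. Q (\<lambda>t. orient (b t) (g t)) J} < \<beta>"
proof -
  let ?G = "Pi_pmf {..<T} (0, 0) (\<lambda>_. pmf_of_set (edges n))"
  let ?O = "Pi_pmf {..<T} False (\<lambda>_. bernoulli_pmf (1/2))"
  \<comment> \<open>The seeds move to the first coordinate so that averaging can fix them.\<close>
  have "measure_pmf.prob (pair_pmf (pair_pmf ?O S) ?G) {(seed, g). Q (\<lambda>t. orient (fst seed t) (g t)) (snd seed)} < \<beta>"
    using assms unfolding oriented_process_eq[symmetric] pair_commute_pmf[of ?G]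
    by (simp add: vimage_def case_prod_unfold)
  then show ?thesis
    by (auto dest!: exists_prob_section_less)
qed

text \<open>An expected number O(n) of paths, set against the square \<open>n powr (3/2)\<close> of
  the threshold, gives failure probability of order \<open>n powr - (1/2)\<close>. Any exponent
  strictly between 1/2 and 1 would serve as threshold.\<close>

lemma online_coloring_small_components:
  assumes \<rho>: "0 < \<rho>" "\<rho> < 1"
  shows "\<exists>r0. \<forall>r\<ge>r0. \<exists>K>0. \<forall>n\<ge>2. \<forall>T. real T \<le> \<rho> * real r * (real n - 1) \<longrightarrow>
    (\<exists>b J. measure_pmf.prob (edge_process n T)
       {es. \<exists>c\<le>r. \<exists>C\<in>components_of_graph n (color_class (seeded_alg r b J) \<omega> es c).
              real n powr (3/4) < real (card C)}
     < K * real n powr - (1/2))"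
proof -
  define \<alpha> where "\<alpha> = ln (1 / \<rho>) - (1 - \<rho>)"
  \<comment> \<open>\<open>ln \<rho> \<le> \<rho> - 1\<close> is strict because \<rho> is not
    1.\<close>
  have "\<alpha> > 0"
    using ln_le_minus_one[of \<rho>] ln_eq_minus_one[of \<rho>] \<rho> by (force simp: \<alpha>_def ln_div)
  then have "(\<lambda>r::nat. real r * exp (- (real r * \<alpha> / 2))) \<longlonglongrightarrow> 0"
    by real_asymp
  then have "\<forall>\<^sub>F r in sequentially. real r * exp (- (real r * \<alpha> / 2)) < 1 / 4"
    by (rule order_tendstoD) simp
  then obtain r0 where r0: "\<And>r. r0 \<le> r \<Longrightarrow> real r * exp (- (real r * \<alpha> / 2)) < 1 / 4"
    by (auto simp: eventually_sequentially)
  have "\<exists>b J. measure_pmf.prob (edge_process n T)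
       {es. \<exists>c\<le>r. \<exists>C\<in>components_of_graph n (color_class (seeded_alg r b J) \<omega> es c).
              real n powr (3/4) < real (card C)}
     < (real r / (1 - \<rho>)\<^sup>2 + 3) * real n powr - (1/2)"
    if r: "max 1 r0 \<le> r" and n: "2 \<le> n" and T: "real T \<le> \<rho> * real r * (real n - 1)" for r n T
  proof -
    define s where "s = real n powr (3/4)"
    have s: "0 < s"
      using n by (simp add: s_def)
    have "s\<^sup>2 = real n powr (3/2)"
      by (simp add: s_def power2_eq_square flip: powr_add)
    then have s2: "real n / s\<^sup>2 = real n powr - (1/2)"
      using n powr_diff[of "real n" 1 "3/2"] by simp
    have "measure_pmf.prob (pair_pmf (round_pmf n T) (shift_pmf n r))
        {(x, J). \<exists>c\<le>r. has_component_larger n s (arcs T r J x c)}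
      \<le> (real r / (1 - \<rho>)\<^sup>2 + 2) * real n / s\<^sup>2"
      using r r0[of r] \<open>\<alpha> > 0\<close>
      by (intro prob_any_component_le[OF n _ \<rho> T s \<alpha>_def]) auto
    also have "\<dots> = (real r / (1 - \<rho>)\<^sup>2 + 2) * real n powr - (1/2)"
      by (simp only: s2 flip: times_divide_eq_right)
    \<comment> \<open>Raising 2 to 3 gives the strict inequality that the averaging lemma
      demands.\<close>
    also have "\<dots> < (real r / (1 - \<rho>)\<^sup>2 + 3) * real n powr - (1/2)"
      using n by (intro mult_strict_right_mono) auto
    finally obtain b J where seeds: "measure_pmf.prob (Pi_pmf {..<T} (0, 0) (\<lambda>_. pmf_of_set (edges n)))
        {g. \<exists>c\<le>r. has_component_larger n s (arcs T r J (\<lambda>t. orient (b t) (g t)) c)}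
      < (real r / (1 - \<rho>)\<^sup>2 + 3) * real n powr - (1/2)"
      using exists_seeds_prob_less by blast
    have "measure_pmf.prob (edge_process n T)
        {es. \<exists>c\<le>r. \<exists>C\<in>components_of_graph n (color_class (seeded_alg r b J) \<omega> es c). s < real (card C)}
      \<le> measure_pmf.prob (Pi_pmf {..<T} (0, 0) (\<lambda>_. pmf_of_set (edges n)))
          {g. \<exists>c\<le>r. has_component_larger n s (arcs T r J (\<lambda>t. orient (b t) (g t)) c)}"
      unfolding edge_process_def replicate_pmf_eq_Pi_pmf[where d = "(0, 0)"] measure_map_pmf
    proof (intro measure_pmf.finite_measure_mono subsetI)
      fix g assume "g \<in> (\<lambda>g. map g [0..<T]) -`
        {es. \<exists>c\<le>r. \<exists>C\<in>components_of_graph n (color_class (seeded_alg r b J) \<omega> es c). s < real (card C)}"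
      then show "g \<in> {g. \<exists>c\<le>r. has_component_larger n s (arcs T r J (\<lambda>t. orient (b t) (g t)) c)}"
        using color_class_seeded_alg[of r b J \<omega> g T] unfolding has_component_larger_def by blast
    qed simp
    with seeds show ?thesis
      unfolding s_def by (blast intro: le_less_trans)
  qed
  moreover have "0 < real r / (1 - \<rho>)\<^sup>2 + 3" for r :: nat
    by (simp add: add_nonneg_pos)
  ultimately show ?thesis
    by (intro exI[of _ "max 1 r0"]) blast
qed

section \<open>Choice of constants and passage to the limit\<close>

lemma measure_pair_measure_space_times:
  assumes "prob_space A"
  shows "measure (A \<Otimes>\<^sub>M measure_pmf M) (space A \<times> B) = measure_pmf.prob M B"
proof -
  interpret A: prob_space A
    by fact
  show ?thesis
    by (simp add: measure_def measure_pmf.emeasure_pair_measure_Times A.emeasure_space_1)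
qed

theorem theorem1p2:
  fixes \<epsilon> :: real
  assumes "\<epsilon> > 0"
  shows "\<exists>r0 :: nat. \<forall>r \<ge> r0.
    \<exists>alg :: nat \<Rightarrow> online_alg.
      (\<forall>n. randomized_online_algorithm r (alg n)) \<and>
      (\<exists>f :: nat \<Rightarrow> real. f \<in> o(\<lambda>n. real n) \<and>
        (\<lambda>n. \<P>((\<omega>, es) in random_bits \<Otimes>\<^sub>M
                 measure_pmf (edge_process n (nat \<lfloor>(1 - \<epsilon>) * real r * real n\<rfloor>)).
               \<forall>c < r. \<forall>C \<in> components_of_graph n (color_class (alg n) \<omega> es c).
                 real (card C) \<le> f n)) \<longlonglongrightarrow> 1)"
proof -
  \<comment> \<open>The cap keeps \<open>1 - \<delta>\<close> positive; a larger \<epsilon> only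
    means fewer rounds.\<close>
  define \<delta> where "\<delta> = min \<epsilon> (1/2)"
  \<comment> \<open>Half of the slack \<delta> goes into \<rho>. One quarter pays for the color lost
    to overflow and one for \<open>n - 1\<close> in place of \<open>n\<close>; these need
    \<open>R\<close> and \<open>n\<close> to be at least \<open>4 / \<delta>\<close>.\<close>
  define \<rho> where "\<rho> = 1 - \<delta> / 2"
  have \<delta>: "0 < \<delta>" "\<delta> \<le> \<epsilon>" "\<delta> \<le> 1/2"
    using assms by (auto simp: \<delta>_def)
  then have \<rho>: "0 < \<rho>" "\<rho> < 1"
    by (auto simp: \<rho>_def)
  \<comment> \<open>\<open>undefined\<close> is an arbitrary bit sequence;
    \<open>deterministic\<close> below shows that the color classes do not depend on it.\<close>
  obtain r0 where r0: "\<And>r. r \<ge> r0 \<Longrightarrow> \<exists>K>0. \<forall>n\<ge>2. \<forall>T. real T \<le> \<rho> * real r * (real n - 1) \<longrightarrow>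
    (\<exists>b J. measure_pmf.prob (edge_process n T)
       {es. \<exists>c\<le>r. \<exists>C\<in>components_of_graph n (color_class (seeded_alg r b J) undefined es c).
              real n powr (3/4) < real (card C)}
     < K * real n powr - (1/2))"
    using online_coloring_small_components[OF \<rho>, of undefined] by blast
  define r1 where "r1 = Suc (max (Suc r0) (nat \<lceil>4 / \<delta>\<rceil>))"
  have "\<exists>alg :: nat \<Rightarrow> online_alg.
      (\<forall>n. randomized_online_algorithm r (alg n)) \<and>
      (\<exists>f :: nat \<Rightarrow> real. f \<in> o(\<lambda>n. real n) \<and>
        (\<lambda>n. \<P>((\<omega>, es) in random_bits \<Otimes>\<^sub>M
                 measure_pmf (edge_process n (nat \<lfloor>(1 - \<epsilon>) * real r * real n\<rfloor>)).
               \<forall>c < r. \<forall>C \<in> components_of_graph n (color_class (alg n) \<omega> es c).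
                 real (card C) \<le> f n)) \<longlonglongrightarrow> 1)" if "r1 \<le> r" for r
  proof -
    \<comment> \<open>One of the \<open>r\<close> colors is reserved for the overflow.\<close>
    define R where "R = r - 1"
    have R: "r = Suc R" "r0 \<le> R" "0 < R" "nat \<lceil>4 / \<delta>\<rceil> \<le> R"
      using that max.cobounded1[of "Suc r0" "nat \<lceil>4 / \<delta>\<rceil>"] max.cobounded2[of "nat \<lceil>4 / \<delta>\<rceil>" "Suc r0"]
      unfolding R_def r1_def by linarith+
    have R4: "4 \<le> \<delta> * real R"
    proof -
      have "4 / \<delta> \<le> real R"
        using R(4) by linarith
      then show ?thesis
        using \<delta> by (simp add: field_simps)
    qed
    define T where "T n = nat \<lfloor>(1 - \<epsilon>) * real r * real n\<rfloor>" for n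
    obtain K where K: "\<And>n T. \<lbrakk>2 \<le> n; real T \<le> \<rho> * real R * (real n - 1)\<rbrakk> \<Longrightarrow>
      (\<exists>b J. measure_pmf.prob (edge_process n T)
       {es. \<exists>c\<le>R. \<exists>C\<in>components_of_graph n (color_class (seeded_alg R b J) undefined es c).
              real n powr (3/4) < real (card C)}
       < K * real n powr - (1/2))"
      using r0[OF R(2)] by blast
    define n0 where "n0 = max 2 (nat \<lceil>4 / \<delta>\<rceil>)"
    have T_le: "real (T n) \<le> \<rho> * real R * (real n - 1)" if "n0 \<le> n" for n
    proof -
      have n: "1 \<le> real n" "4 \<le> \<delta> * real n"
      proof -
        have "4 / \<delta> \<le> real n"
          using that unfolding n0_def by linarith
        then show "4 \<le> \<delta> * real n"
          using \<delta> by (simp add: field_simps)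
      qed (use that in \<open>simp add: n0_def\<close>)
      have "(1 - \<epsilon>) * real r * real n \<le> (1 - \<delta>) * real r * real n"
        using \<delta> by (intro mult_right_mono) auto
      \<comment> \<open>For \<open>\<epsilon> > 1\<close> the floor is negative and
        \<open>nat\<close> turns it into 0, so the bound \<open>u\<close> has to be
        nonnegative.\<close>
      moreover have nat_floor_le: "real (nat \<lfloor>y\<rfloor>) \<le> u" if "y \<le> u" "0 \<le> u" for y u :: real
        using that by linarith
      ultimately have "real (T n) \<le> (1 - \<delta>) * real r * real n"
        using \<delta> unfolding T_def by (intro nat_floor_le) auto
      also have "\<dots> \<le> (1 - 3 * \<delta> / 4) * real R * real n"
        using R4 \<delta> by (intro mult_right_mono) (simp_all add: R(1) algebra_simps)
      also have "\<dots> = real R * ((1 - 3 * \<delta> / 4) * real n)"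
        by simp
      also have "\<dots> \<le> real R * (\<rho> * (real n - 1))"
      proof (rule mult_left_mono)
        have "\<rho> * (real n - 1) = real n - 1 - \<delta> * real n / 2 + \<delta> / 2"
          by (simp add: \<rho>_def field_simps)
        moreover have "(1 - 3 * \<delta> / 4) * real n = real n - 3 / 4 * (\<delta> * real n)"
          by (simp add: field_simps)
        ultimately show "(1 - 3 * \<delta> / 4) * real n \<le> \<rho> * (real n - 1)"
          using n(2) \<delta>(1) by linarith
      qed simp
      finally show ?thesis
        by (simp add: mult_ac)
    qed
    define good_seed where "good_seed n seed \<longleftrightarrow> measure_pmf.prob (edge_process n (T n))
       {es. \<exists>c\<le>R. \<exists>C\<in>components_of_graph n (color_class (seeded_alg R (fst seed) (snd seed)) undefined es c).
              real n powr (3/4) < real (card C)}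
       < K * real n powr - (1/2)" for n seed
    have "\<exists>seed. n0 \<le> n \<longrightarrow> good_seed n seed" for n
    proof (cases "n0 \<le> n")
      case True
      then have "2 \<le> n"
        by (simp add: n0_def)
      from K[OF this T_le[OF True]] show ?thesis
        by (simp add: good_seed_def split_paired_Ex)
    qed simp
    then obtain seed where seed: "\<And>n. n0 \<le> n \<Longrightarrow> good_seed n (seed n)"
      by metis
    define alg where "alg n = seeded_alg R (fst (seed n)) (snd (seed n))" for n
    define f where "f n = real n powr (3/4)" for n
    let ?good = "\<lambda>n es. \<forall>c<r. \<forall>C\<in>components_of_graph n (color_class (alg n) undefined es c). real (card C) \<le> f n"
    let ?P = "\<lambda>n. measure_pmf.prob (edge_process n (T n)) {es. ?good n es}"
    have prob_space: "prob_space random_bits"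
      unfolding random_bits_def by (intro prob_space_PiM measure_pmf.prob_space_axioms)
    have deterministic: "color_class (alg n) \<omega> es c = color_class (alg n) undefined es c" for n \<omega> es c
      by (simp add: color_class_def alg_def seeded_alg_def)
    \<comment> \<open>The event is the whole space of bits times a set of edge sequences, so the
      bits integrate out.\<close>
    have P: "\<P>((\<omega>, es) in random_bits \<Otimes>\<^sub>M measure_pmf (edge_process n (T n)).
        \<forall>c < r. \<forall>C \<in> components_of_graph n (color_class (alg n) \<omega> es c). real (card C) \<le> f n) = ?P n" for n
      unfolding measure_pair_measure_space_times[OF prob_space, symmetric]
      by (intro arg_cong[where f = "measure _"]) (auto simp: space_pair_measure; metis deterministic)
    have "1 - K * real n powr - (1/2) \<le> ?P n" if "n0 \<le> n" for n
    proof -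
      have "{es. \<exists>c\<le>R. \<exists>C\<in>components_of_graph n (color_class (alg n) undefined es c).
          real n powr (3/4) < real (card C)} = UNIV - {es. ?good n es}"
        by (simp add: set_eq_iff R(1) f_def not_le less_Suc_eq_le)
      then have "1 - ?P n < K * real n powr - (1/2)"
        using seed[OF that] measure_pmf.prob_compl[of "{es. ?good n es}" "edge_process n (T n)"]
        by (simp add: alg_def good_seed_def)
      then show ?thesis
        by simp
    qed
    then have "\<forall>\<^sub>F n in sequentially. 1 - K * real n powr - (1/2) \<le> ?P n"
      by (auto simp: eventually_sequentially)
    moreover have "(\<lambda>n. 1 - K * real n powr - (1/2)) \<longlonglongrightarrow> 1"
      by real_asymp
    ultimately have lim: "?P \<longlonglongrightarrow> 1"
      by (intro tendsto_sandwich[of "\<lambda>n. 1 - K * real n powr - (1/2)" ?P _ "\<lambda>_. 1"]) auto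
    have f: "f \<in> o(\<lambda>n. real n)"
      unfolding f_def by real_asymp
    \<comment> \<open>The color is constant in the bits, hence measurable, and the largest color is
      \<open>R = r - 1\<close>.\<close>
    have online: "randomized_online_algorithm r (alg n)" for n
      using round_color_le[OF R(3)]
      by (auto simp: randomized_online_algorithm_def alg_def seeded_alg_def R(1) less_Suc_eq_le)
    show ?thesis
      unfolding T_def[symmetric]
    proof (intro exI[of _ alg] conjI allI online exI[of _ f] f)
      show "(\<lambda>n. \<P>((\<omega>, es) in random_bits \<Otimes>\<^sub>M measure_pmf (edge_process n (T n)).
          \<forall>c < r. \<forall>C \<in> components_of_graph n (color_class (alg n) \<omega> es c). real (card C) \<le> f n)) \<longlonglongrightarrow> 1"
        unfolding P by (rule lim)
    qed
  qed
  then show ?thesis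
    by blast
qed

end
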